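(* Let $h_5$ be a non-zero homogeneous harmonic polynomial of degree $5$ in $(x,y)$ and let $\rho_6 \colon (\mathbf{R}^2,\mathbf{0}) \to (\mathbf{R},0)$ be a homogeneous $3$-harmonic polynomial of degree $6$. Then the germ at the origin of $h_5 + \rho_6$ is right-equivalent to that of $h_5$.
   Context: $\mathbf{R}^2$ has coordinates $(x,y)$ and $\Delta = \frac{\partial^2}{\partial x^2} + \frac{\partial^2}{\partial y^2}$ is the Laplacian. A function $h$ is harmonic if $\Delta h = 0$, and $l$-harmonic if $\Delta^l h = 0$. Two $C^\infty$ function-germs $h_1,h_2\colon (\mathbf{R}^2,\mathbf{0}) \to (\mathbf{R},0)$ are right-equivalent if there is a $C^\infty$ diffeomorphism-germ $\tau \colon (\mathbf{R}^2,\mathbf{0}) \to (\mathbf{R}^2,\mathbf{0})$ with $h_1 \circ \tau = h_2$. *)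

theory Defs
  imports "HOL-Analysis.Analysis"
begin

text \<open>
  \<open>Ck_on k U f\<close>: the function \<open>f\<close> is of class \<open>C\<^sup>k\<close> on \<open>U\<close>. Only meant for open \<open>U\<close>, since the
  derivatives are taken in the ambient space. Differentiability is total (Frechet), and continuity
  of all directional derivatives is continuity of the derivative because the domain is
  finite-dimensional.
\<close>

fun Ck_on :: "nat \<Rightarrow> 'a::euclidean_space set \<Rightarrow> ('a \<Rightarrow> 'b::real_normed_vector) \<Rightarrow> bool" where
  "Ck_on 0 U f \<longleftrightarrow> continuous_on U f"
| "Ck_on (Suc k) U f \<longleftrightarrow>
     (\<forall>p\<in>U. f differentiable (at p)) \<and> (\<forall>v. Ck_on k U (\<lambda>p. frechet_derivative f (at p) v))"

definition smooth_on :: "'a::euclidean_space set \<Rightarrow> ('a \<Rightarrow> 'b::real_normed_vector) \<Rightarrow> bool" where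
  "smooth_on U f \<longleftrightarrow> (\<forall>k. Ck_on k U f)"

definition partial_x :: "(real \<times> real \<Rightarrow> real) \<Rightarrow> real \<times> real \<Rightarrow> real" where
  "partial_x f = (\<lambda>(x, y). deriv (\<lambda>t. f (t, y)) x)"

definition partial_y :: "(real \<times> real \<Rightarrow> real) \<Rightarrow> real \<times> real \<Rightarrow> real" where
  "partial_y f = (\<lambda>(x, y). deriv (\<lambda>t. f (x, t)) y)"

definition laplacian :: "(real \<times> real \<Rightarrow> real) \<Rightarrow> real \<times> real \<Rightarrow> real" where
  "laplacian f = (\<lambda>p. partial_x (partial_x f) p + partial_y (partial_y f) p)"

text \<open>
  The regularity conjunct excludes functions for which \<open>deriv\<close> returns an arbitrary value;
  polynomials satisfy it automatically.
\<close>

definition l_harmonic :: "nat \<Rightarrow> (real \<times> real \<Rightarrow> real) \<Rightarrow> bool" where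
  "l_harmonic l h \<longleftrightarrow> Ck_on (2 * l) UNIV h \<and> (laplacian ^^ l) h = (\<lambda>_. 0)"

definition harmonic :: "(real \<times> real \<Rightarrow> real) \<Rightarrow> bool" where
  "harmonic h \<longleftrightarrow> Ck_on 2 UNIV h \<and> laplacian h = (\<lambda>_. 0)"

text \<open>The zero polynomial counts as homogeneous of every degree.\<close>

definition homogeneous_poly :: "nat \<Rightarrow> (real \<times> real \<Rightarrow> real) \<Rightarrow> bool" where
  "homogeneous_poly d f \<longleftrightarrow> (\<exists>c. f = (\<lambda>(x, y). \<Sum>i\<le>d. c i * x ^ i * y ^ (d - i)))"

text \<open>
  Germs at the origin are given by total functions as representatives; the values away from a
  neighbourhood of the origin are irrelevant, see \<open>right_equivalent_germ_cong\<close> below.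
\<close>

definition smooth_function_germ :: "(real \<times> real \<Rightarrow> real) \<Rightarrow> bool" where
  "smooth_function_germ h \<longleftrightarrow> (\<exists>U. open U \<and> 0 \<in> U \<and> smooth_on U h) \<and> h 0 = 0"

definition diffeomorphism_germ :: "(real \<times> real \<Rightarrow> real \<times> real) \<Rightarrow> bool" where
  "diffeomorphism_germ \<tau> \<longleftrightarrow> \<tau> 0 = 0 \<and>
     (\<exists>U V \<sigma>. open U \<and> open V \<and> 0 \<in> U \<and> homeomorphism U V \<tau> \<sigma> \<and> smooth_on U \<tau> \<and> smooth_on V \<sigma>)"

definition right_equivalent :: "(real \<times> real \<Rightarrow> real) \<Rightarrow> (real \<times> real \<Rightarrow> real) \<Rightarrow> bool" where
  "right_equivalent h1 h2 \<longleftrightarrow> smooth_function_germ h1 \<and> smooth_function_germ h2 \<and>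
     (\<exists>\<tau>. diffeomorphism_germ \<tau> \<and> eventually (\<lambda>p. (h1 \<circ> \<tau>) p = h2 p) (nhds 0))"

lemma Ck_on_subset: "Ck_on k U f \<Longrightarrow> V \<subseteq> U \<Longrightarrow> Ck_on k V f"
  by (induction k arbitrary: f) (auto intro: continuous_on_subset)

lemma Ck_on_cong:
  assumes "open U" "\<And>p. p \<in> U \<Longrightarrow> f p = g p" "Ck_on k U f"
  shows "Ck_on k U g"
  using assms(2,3)
proof (induction k arbitrary: f g)
  case 0
  then show ?case by (simp cong: continuous_on_cong)
next
  case (Suc k)
  have D: "(f has_derivative D) (at p) \<longleftrightarrow> (g has_derivative D) (at p)" if "p \<in> U" for p D
    using Suc.prems(1) that assms(1)
    by (metis has_derivative_transform_within_open)
  have "frechet_derivative f (at p) = frechet_derivative g (at p)" if "p \<in> U" for p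
    using D[OF that] by (simp add: frechet_derivative_def)
  then have "Ck_on k U (\<lambda>p. frechet_derivative g (at p) v)" for v
    using Suc.IH[of "\<lambda>p. frechet_derivative f (at p) v" "\<lambda>p. frechet_derivative g (at p) v"]
      Suc.prems(2) by simp
  moreover have "\<forall>p\<in>U. g differentiable (at p)"
    using Suc.prems(2) D by (auto simp: differentiable_def)
  ultimately show ?case by simp
qed

lemma smooth_function_germ_cong:
  assumes "smooth_function_germ f" "eventually (\<lambda>p. f p = g p) (nhds 0)"
  shows "smooth_function_germ g"
proof -
  obtain U where U: "open U" "0 \<in> U" "smooth_on U f" and f0: "f 0 = 0"
    using assms(1) by (auto simp: smooth_function_germ_def)
  obtain W where W: "open W" "0 \<in> W" "\<And>p. p \<in> W \<Longrightarrow> f p = g p"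
    using assms(2) by (auto simp: eventually_nhds)
  have "smooth_on (U \<inter> W) g"
    unfolding smooth_on_def
  proof
    fix k
    show "Ck_on k (U \<inter> W) g"
      by (rule Ck_on_cong[of _ f]) (use U W in \<open>auto simp: smooth_on_def intro: Ck_on_subset\<close>)
  qed
  then show ?thesis
    using U W f0 by (metis Int_iff open_Int smooth_function_germ_def)
qed

lemma right_equivalent_germ_cong:
  assumes "right_equivalent f g"
    and ff: "eventually (\<lambda>p. f p = f' p) (nhds 0)" and gg: "eventually (\<lambda>p. g p = g' p) (nhds 0)"
  shows "right_equivalent f' g'"
proof -
  obtain \<tau> where t: "diffeomorphism_germ \<tau>" "eventually (\<lambda>p. (f \<circ> \<tau>) p = g p) (nhds 0)"
    using assms(1) by (auto simp: right_equivalent_def)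
  then obtain U V \<sigma> where U: "open U" "0 \<in> U" "homeomorphism U V \<tau> \<sigma>" and t0: "\<tau> 0 = 0"
    by (auto simp: diffeomorphism_germ_def)
  have "isCont \<tau> 0"
    using U homeomorphism_cont1 continuous_on_eq_continuous_at by blast
  then have "filterlim \<tau> (nhds 0) (nhds 0)"
    using t0 isCont_def tendsto_nhds_iff by metis
  then have "eventually (\<lambda>p. f (\<tau> p) = f' (\<tau> p)) (nhds 0)"
    using ff by (auto simp: filterlim_iff)
  with t(2) gg have "eventually (\<lambda>p. (f' \<circ> \<tau>) p = g' p) (nhds 0)"
    by eventually_elim simp
  then show ?thesis
    using assms t(1) smooth_function_germ_cong unfolding right_equivalent_def by blast
qed

end

theory Submission
  imports Defs
begin

text \<open>
  Put \<open>z = x + iy\<close> and write \<open>z'\<close> for its conjugate. A harmonic quintic is \<open>Re (g z\<^sup>5)\<close>, and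
  3-harmonicity of \<open>\<rho>6\<close> says precisely that the monomial \<open>z\<^sup>3 z'\<^sup>3\<close> is absent, so that
  \<open>\<rho>6 = Re (a z\<^sup>6 + b z\<^sup>5 z' + c z\<^sup>4 z'\<^sup>2)\<close>. One looks for a coordinate change
  \<open>\<sigma>(z) = z (1 + \<alpha>) + z'\<^sup>2 \<beta>\<close>, with smooth \<open>\<alpha>\<close>, \<open>\<beta>\<close> and \<open>\<alpha>(0) = 0\<close>, such that
  \<open>Re (g \<sigma>\<^sup>5) = h5 + \<rho>6\<close>. The terms of \<open>g \<sigma>\<^sup>5\<close> of order at least two in \<open>z'\<^sup>2 \<beta>\<close> are multiples of
  \<open>z'\<^sup>4\<close>; replacing them by their conjugates does not change the real part and makes the whole
  expression divisible by \<open>z\<^sup>4\<close>. Comparing the coefficients of \<open>z\<^sup>5\<close> and \<open>z\<^sup>4 z'\<^sup>2\<close> gives two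
  equations for \<open>(\<alpha>, \<beta>)\<close> with invertible linearization at \<open>z = 0\<close>, \<open>\<alpha> = 0\<close>, \<open>\<beta> = c / (5 g)\<close>,
  which are solved by the inverse function theorem. Then \<open>\<sigma>\<close> has derivative the identity at the
  origin, and its inverse is the required diffeomorphism germ.
\<close>

subsection \<open>Calculus of \<open>C\<^sup>k\<close> and smooth maps\<close>

text \<open>By uniqueness of derivatives on an open set, any explicit family \<open>D\<close> may
  replace \<open>frechet_derivative\<close>. With its converse \<open>Ck_on_SucE\<close>, this rule
  drives the inductions on \<open>k\<close> below.\<close>

lemma Ck_on_SucI:
  assumes "open U" "\<And>p. p \<in> U \<Longrightarrow> (f has_derivative D p) (at p)"
    and "\<And>v. Ck_on k U (\<lambda>p. D p v)"
  shows "Ck_on (Suc k) U f"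
  unfolding Ck_on.simps
proof (intro conjI ballI allI)
  show "f differentiable (at p)" if "p \<in> U" for p
    using assms(2)[OF that] by (auto simp: differentiable_def)
  show "Ck_on k U (\<lambda>p. frechet_derivative f (at p) v)" for v
    by (rule Ck_on_cong[OF assms(1) _ assms(3)[of v]]) (metis assms(2) frechet_derivative_at)
qed

lemma Ck_on_SucE:
  assumes "Ck_on (Suc k) U f"
  obtains D where "\<And>p. p \<in> U \<Longrightarrow> (f has_derivative D p) (at p)"
    and "\<And>v. Ck_on k U (\<lambda>p. D p v)"
  using assms by (metis Ck_on.simps(2) frechet_derivative_works)

lemma Ck_on_SucD: "Ck_on (Suc k) U f \<Longrightarrow> Ck_on k U f"
proof (induction k arbitrary: f)
  case 0
  then show ?case
    by (auto intro!: differentiable_imp_continuous_on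
        simp: differentiable_on_def differentiable_at_withinI)
next
  case (Suc k)
  then show ?case by (subst Ck_on.simps) (auto simp del: Ck_on.simps(2) simp: Ck_on.simps(2)[of "Suc k"])
qed

lemma Ck_on_const [simp]: "open U \<Longrightarrow> Ck_on k U (\<lambda>p. c)"
proof (induction k arbitrary: c)
  case (Suc k)
  then show ?case by (intro Ck_on_SucI[where D="\<lambda>p v. 0"]) auto
qed simp

lemma Ck_on_bounded_linear:
  assumes "bounded_linear h" "open U" "Ck_on k U f"
  shows "Ck_on k U (\<lambda>p. h (f p))"
  using assms(3)
proof (induction k arbitrary: f)
  case 0
  then show ?case by (simp add: bounded_linear.continuous_on[OF assms(1)])
next
  case (Suc k)
  obtain D where D: "\<And>p. p \<in> U \<Longrightarrow> (f has_derivative D p) (at p)"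
    "\<And>v. Ck_on k U (\<lambda>p. D p v)" using Ck_on_SucE[OF Suc.prems] by metis
  show ?case
    by (rule Ck_on_SucI[where D="\<lambda>p v. h (D p v)"])
      (use assms D Suc.IH in \<open>auto intro: bounded_linear.has_derivative\<close>)
qed

lemma Ck_on_add:
  assumes "open U" "Ck_on k U f" "Ck_on k U g"
  shows "Ck_on k U (\<lambda>p. f p + g p)"
  using assms(2,3)
proof (induction k arbitrary: f g)
  case 0
  then show ?case by (simp add: continuous_on_add)
next
  case (Suc k)
  obtain D where D: "\<And>p. p \<in> U \<Longrightarrow> (f has_derivative D p) (at p)"
    "\<And>v. Ck_on k U (\<lambda>p. D p v)" using Ck_on_SucE[OF Suc.prems(1)] by metis
  obtain E where E: "\<And>p. p \<in> U \<Longrightarrow> (g has_derivative E p) (at p)"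
    "\<And>v. Ck_on k U (\<lambda>p. E p v)" using Ck_on_SucE[OF Suc.prems(2)] by metis
  show ?case
    by (rule Ck_on_SucI[where D="\<lambda>p v. D p v + E p v"])
      (use assms D E Suc.IH in \<open>auto intro: has_derivative_add\<close>)
qed

lemma Ck_on_sum:
  assumes "open U" "\<And>i. i \<in> I \<Longrightarrow> Ck_on k U (f i)"
  shows "Ck_on k U (\<lambda>p. \<Sum>i\<in>I. f i p)"
  using assms(2)
  by (induction I rule: infinite_finite_induct) (auto intro!: Ck_on_add assms(1) Ck_on_const[OF assms(1)])

lemma (in bounded_bilinear) Ck_on_prod:
  assumes "open U" "Ck_on k U f" "Ck_on k U g"
  shows "Ck_on k U (\<lambda>p. prod (f p) (g p))"
  using assms(2,3)
proof (induction k arbitrary: f g)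
  case 0
  then show ?case by (simp add: continuous_on)
next
  case (Suc k)
  obtain D where D: "\<And>p. p \<in> U \<Longrightarrow> (f has_derivative D p) (at p)"
    "\<And>v. Ck_on k U (\<lambda>p. D p v)" using Ck_on_SucE[OF Suc.prems(1)] by metis
  obtain E where E: "\<And>p. p \<in> U \<Longrightarrow> (g has_derivative E p) (at p)"
    "\<And>v. Ck_on k U (\<lambda>p. E p v)" using Ck_on_SucE[OF Suc.prems(2)] by metis
  show ?case
  proof (rule Ck_on_SucI[where D="\<lambda>p v. prod (f p) (E p v) + prod (D p v) (g p)"])
    \<comment> \<open>The product rule keeps one factor undifferentiated in each summand, so
      \<open>f\<close> and \<open>g\<close> themselves are first lowered to class
      \<open>k\<close>.\<close>
    show "Ck_on k U (\<lambda>p. prod (f p) (E p v) + prod (D p v) (g p))" for v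
      by (intro Ck_on_add Suc.IH Ck_on_SucD[OF Suc.prems(1)] Ck_on_SucD[OF Suc.prems(2)] D(2) E(2) assms(1))
  qed (use assms D E in \<open>auto intro: FDERIV\<close>)
qed

text \<open>Expanding \<open>u p\<close> in the standard basis turns \<open>M p (u p)\<close> into a
  sum of scalar functions times \<open>M p b\<close> with \<open>b\<close> fixed. This handles
  derivatives at a moving argument without operator-valued maps.\<close>

lemma Ck_on_linear_family_apply:
  fixes u :: "'a::euclidean_space \<Rightarrow> 'c::euclidean_space"
  assumes "open U" "\<And>p. p \<in> U \<Longrightarrow> linear (M p)" "\<And>v. Ck_on k U (\<lambda>p. M p v)" "Ck_on k U u"
  shows "Ck_on k U (\<lambda>p. M p (u p))"
proof (rule Ck_on_cong[OF assms(1)])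
  show "(\<Sum>b\<in>Basis. (u p \<bullet> b) *\<^sub>R M p b) = M p (u p)" if "p \<in> U" for p
  proof -
    have "M p (u p) = M p (\<Sum>b\<in>Basis. (u p \<bullet> b) *\<^sub>R b)"
      by (simp add: euclidean_representation)
    also have "\<dots> = (\<Sum>b\<in>Basis. (u p \<bullet> b) *\<^sub>R M p b)"
      using assms(2)[OF that] by (simp add: linear_sum linear_cmul)
    finally show ?thesis by simp
  qed
  show "Ck_on k U (\<lambda>p. \<Sum>b\<in>Basis. (u p \<bullet> b) *\<^sub>R M p b)"
    by (intro Ck_on_sum bounded_bilinear.Ck_on_prod[OF bounded_bilinear_scaleR]
        Ck_on_bounded_linear[OF bounded_linear_inner_left] assms)
qed

text \<open>The chain rule gives the derivative \<open>E (f p) (D p v)\<close>, a linear family at a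
  moving argument. The family is of class \<open>k\<close> by the induction hypothesis for the outer
  map \<open>\<lambda>q. E q v\<close>, which is why \<open>g\<close> is generalized while
  \<open>f\<close> stays fixed.\<close>

lemma Ck_on_compose:
  fixes f :: "'a::euclidean_space \<Rightarrow> 'c::euclidean_space"
  assumes "open U" "open W" "f ` U \<subseteq> W" "Ck_on k U f" "Ck_on k W g"
  shows "Ck_on k U (\<lambda>p. g (f p))"
  using assms(4,5)
proof (induction k arbitrary: g)
  case 0
  then show ?case using assms(3) by (auto intro: continuous_on_compose2)
next
  case (Suc k)
  obtain D where D: "\<And>p. p \<in> U \<Longrightarrow> (f has_derivative D p) (at p)"
    "\<And>v. Ck_on k U (\<lambda>p. D p v)" using Ck_on_SucE[OF Suc.prems(1)] by metis
  obtain E where E: "\<And>p. p \<in> W \<Longrightarrow> (g has_derivative E p) (at p)"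
    "\<And>v. Ck_on k W (\<lambda>p. E p v)" using Ck_on_SucE[OF Suc.prems(2)] by metis
  have fW: "f p \<in> W" if "p \<in> U" for p using assms(3) that by auto
  show ?case
  proof (rule Ck_on_SucI[where D="\<lambda>p v. E (f p) (D p v)"])
    show "((\<lambda>p. g (f p)) has_derivative (\<lambda>v. E (f p) (D p v))) (at p)" if "p \<in> U" for p
      using has_derivative_compose[OF D(1)[OF that] E(1)[OF fW[OF that]]] .
    show "Ck_on k U (\<lambda>p. E (f p) (D p v))" for v
    proof (rule Ck_on_linear_family_apply)
      show "linear (E (f p))" if "p \<in> U" for p
        using E(1)[OF fW[OF that]] by (rule has_derivative_linear)
      show "Ck_on k U (\<lambda>p. E (f p) v)" for v
        using Suc.IH[OF Ck_on_SucD[OF Suc.prems(1)] E(2)] .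
    qed (use assms D in auto)
  qed (rule assms)
qed

lemma Ck_on_Pair:
  assumes "open U" "Ck_on k U f" "Ck_on k U g"
  shows "Ck_on k U (\<lambda>p. (f p, g p))"
proof -
  have "Ck_on k U (\<lambda>p. (f p, 0) + (0, g p))"
    by (intro Ck_on_add Ck_on_bounded_linear[where f=f and h="\<lambda>x. (x, 0)"]
        Ck_on_bounded_linear[where f=g and h="\<lambda>x. (0, x)"] assms bounded_linear_Pair
        bounded_linear_ident bounded_linear_zero)
  then show ?thesis by simp
qed

section \<open>Closure properties of smooth maps\<close>

lemma smooth_on_subset: "smooth_on U f \<Longrightarrow> V \<subseteq> U \<Longrightarrow> smooth_on V f"
  unfolding smooth_on_def using Ck_on_subset by blast

lemma smooth_on_bounded_linear:
  "bounded_linear h \<Longrightarrow> open U \<Longrightarrow> smooth_on U f \<Longrightarrow> smooth_on U (\<lambda>p. h (f p))"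
  unfolding smooth_on_def using Ck_on_bounded_linear by blast

lemma smooth_on_const: "open U \<Longrightarrow> smooth_on U (\<lambda>p. c)"
  unfolding smooth_on_def by simp

lemma smooth_on_ident: "open U \<Longrightarrow> smooth_on U (\<lambda>p. p)"
  unfolding smooth_on_def
proof
  show "Ck_on k U (\<lambda>p. p)" if "open U" for k
  proof (cases k)
    case (Suc m)
    show ?thesis
      unfolding Suc by (rule Ck_on_SucI[where D="\<lambda>p v. v"]) (use that in \<open>auto\<close>)
  qed simp
qed

lemma smooth_on_add:
  "open U \<Longrightarrow> smooth_on U f \<Longrightarrow> smooth_on U g \<Longrightarrow> smooth_on U (\<lambda>p. f p + g p)"
  unfolding smooth_on_def using Ck_on_add by blast

lemma smooth_on_minus: "open U \<Longrightarrow> smooth_on U f \<Longrightarrow> smooth_on U (\<lambda>p. - f p)"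
  by (rule smooth_on_bounded_linear[OF bounded_linear_minus[OF bounded_linear_ident]])

lemma smooth_on_diff:
  "open U \<Longrightarrow> smooth_on U f \<Longrightarrow> smooth_on U g \<Longrightarrow> smooth_on U (\<lambda>p. f p - g p)"
  using smooth_on_add[OF _ _ smooth_on_minus] by fastforce

lemma smooth_on_mult:
  fixes f :: "'a::euclidean_space \<Rightarrow> 'b::real_normed_algebra"
  shows "open U \<Longrightarrow> smooth_on U f \<Longrightarrow> smooth_on U g \<Longrightarrow> smooth_on U (\<lambda>p. f p * g p)"
  unfolding smooth_on_def using bounded_bilinear.Ck_on_prod[OF bounded_bilinear_mult] by blast

lemma smooth_on_power:
  fixes f :: "'a::euclidean_space \<Rightarrow> 'b::real_normed_algebra_1"
  shows "open U \<Longrightarrow> smooth_on U f \<Longrightarrow> smooth_on U (\<lambda>p. f p ^ n)"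
  by (induction n) (simp_all add: smooth_on_const smooth_on_mult)

lemma smooth_on_sum:
  assumes "open U" "\<And>i. i \<in> I \<Longrightarrow> smooth_on U (f i)"
  shows "smooth_on U (\<lambda>p. \<Sum>i\<in>I. f i p)"
  using assms unfolding smooth_on_def by (auto intro: Ck_on_sum)

lemma smooth_on_Pair:
  "open U \<Longrightarrow> smooth_on U f \<Longrightarrow> smooth_on U g \<Longrightarrow> smooth_on U (\<lambda>p. (f p, g p))"
  unfolding smooth_on_def using Ck_on_Pair by blast

lemma smooth_on_compose:
  fixes f :: "'a::euclidean_space \<Rightarrow> 'c::euclidean_space"
  shows "open U \<Longrightarrow> open W \<Longrightarrow> f ` U \<subseteq> W \<Longrightarrow> smooth_on U f \<Longrightarrow> smooth_on W g \<Longrightarrow>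
    smooth_on U (\<lambda>p. g (f p))"
  unfolding smooth_on_def using Ck_on_compose by blast

lemmas smooth_on_intros = smooth_on_const smooth_on_ident smooth_on_add
  smooth_on_diff smooth_on_mult smooth_on_power smooth_on_sum smooth_on_Pair
  smooth_on_bounded_linear[OF bounded_linear_fst] smooth_on_bounded_linear[OF bounded_linear_snd]
  smooth_on_bounded_linear[OF bounded_linear_cnj]

subsection \<open>The inverse function theorem for smooth maps\<close>

text \<open>A perturbation argument: if \<open>C\<close> bounds \<open>M p\<close> and
  \<open>L q\<close> is within \<open>1 / (2 * C)\<close> of \<open>L p\<close> in operator norm,
  then \<open>norm u \<le> C * norm (L q u) + norm u / 2\<close>. Absorbing the last term bounds
  \<open>M q\<close> by \<open>2 * C\<close>, uniformly for \<open>q\<close> near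
  \<open>p\<close>.\<close>

lemma linear_family_inverse_bound:
  fixes L :: "'a::euclidean_space \<Rightarrow> 'b::euclidean_space \<Rightarrow> 'b"
  assumes U: "open U" and p: "p \<in> U"
    and L: "\<And>p. p \<in> U \<Longrightarrow> linear (L p)" "\<And>v. continuous_on U (\<lambda>p. L p v)"
    and M: "\<And>p v. p \<in> U \<Longrightarrow> M p (L p v) = v" "\<And>p v. p \<in> U \<Longrightarrow> L p (M p v) = v"
    and linM: "linear (M p)"
  obtains C where "C > 0" "eventually (\<lambda>q. \<forall>w. norm (M q w) \<le> C * norm w) (nhds p)"
proof -
  obtain C where C: "C > 0" "\<And>w. norm (M p w) \<le> C * norm w"
    using linear_bounded_pos[OF linM] by metis
  have A: "blinfun_apply (Blinfun (L q)) = L q" if "q \<in> U" for q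
    using L(1)[OF that] by (simp add: bounded_linear_Blinfun_apply linear_conv_bounded_linear)
  have "continuous_on U (\<lambda>q. Blinfun (L q))"
    using L(2) by (intro continuous_on_blinfun_componentwise) (simp add: A cong: continuous_on_cong)
  then have "((\<lambda>q. Blinfun (L q)) \<longlongrightarrow> Blinfun (L p)) (nhds p)"
    using U p continuous_on_eq_continuous_at tendsto_nhds_iff isCont_def by metis
  then have "eventually (\<lambda>q. dist (Blinfun (L q)) (Blinfun (L p)) < 1 / (2 * C)) (nhds p)"
    using C(1) by (intro tendstoD) auto
  moreover have "eventually (\<lambda>q. q \<in> U) (nhds p)" using U p by (rule eventually_nhds_in_open)
  ultimately have "eventually (\<lambda>q. \<forall>w. norm (M q w) \<le> 2 * C * norm w) (nhds p)"
  proof eventually_elim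
    case (elim q)
    show ?case
    proof
      fix w
      define u where "u = M q w"
      have "norm (L q u - L p u) \<le> norm (Blinfun (L q) - Blinfun (L p)) * norm u"
        using norm_blinfun[of "Blinfun (L q) - Blinfun (L p)" u] A p elim by (simp add: blinfun.diff_left)
      also have "\<dots> \<le> 1 / (2 * C) * norm u"
        using elim by (intro mult_right_mono) (auto simp: dist_norm)
      finally have 1: "norm (L q u - L p u) \<le> 1 / (2 * C) * norm u" .
      have "norm u \<le> C * norm (L p u)" using C(2)[of "L p u"] M p by simp
      also have "\<dots> \<le> C * (norm (L q u) + 1 / (2 * C) * norm u)"
        using 1 norm_triangle_sub[of "L p u" "L q u"] C(1)
        by (intro mult_left_mono) (auto simp: norm_minus_commute)
      also have "\<dots> = C * norm (L q u) + norm u / 2" using C(1) by (simp add: field_simps)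
      finally have "norm u \<le> 2 * C * norm (L q u)" by simp
      then show "norm (M q w) \<le> 2 * C * norm w" using M(2) elim by (simp add: u_def)
    qed
  qed
  then show ?thesis using that[of "2 * C"] C(1) by auto
qed

text \<open>Differentiating \<open>L p (M p v) = v\<close> shows that the derivative of the inverse
  is minus \<open>M\<close>, after the derivative of \<open>L\<close>, after \<open>M\<close>. Only
  \<open>M\<close> itself occurs in it, so class \<open>k\<close> of \<open>M\<close> yields class
  \<open>Suc k\<close>. Continuity, and the differentiability behind the formula, rest on the local
  bound for \<open>M q\<close>.\<close>

lemma Ck_on_linear_family_inverse:
  fixes L :: "'a::euclidean_space \<Rightarrow> 'b::euclidean_space \<Rightarrow> 'b"
  assumes U: "open U"
    and L: "\<And>p. p \<in> U \<Longrightarrow> linear (L p)" "\<And>v. Ck_on k U (\<lambda>p. L p v)"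
    and M: "\<And>p v. p \<in> U \<Longrightarrow> M p (L p v) = v" "\<And>p v. p \<in> U \<Longrightarrow> L p (M p v) = v"
  shows "Ck_on k U (\<lambda>p. M p v)"
proof -
  have linM: "linear (M p)" if "p \<in> U" for p
  proof (rule linearI)
    note lin = L(1)[OF that] and inv = M[OF that]
    show "M p (x + y) = M p x + M p y" for x y
      using inv(1)[of "M p x + M p y"] linear_add[OF lin, of "M p x" "M p y"] inv(2) by simp
    show "M p (c *\<^sub>R x) = c *\<^sub>R M p x" for c x
      using inv(1)[of "c *\<^sub>R M p x"] linear_cmul[OF lin, of c "M p x"] inv(2) by simp
  qed
  have contL: "continuous_on U (\<lambda>p. L p v)" for v
    using L(2)[of v]
  proof (induction k)
    case (Suc k) then show ?case using Ck_on_SucD by blast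
  qed simp
  have bnd: "\<exists>C>0. eventually (\<lambda>q. \<forall>w. norm (M q w) \<le> C * norm w) (nhds p)" if "p \<in> U" for p
    using linear_family_inverse_bound[OF U that L(1) contL M linM[OF that]] by metis
  have ev: "eventually (\<lambda>q. q \<in> U) (nhds p)" if "p \<in> U" for p
    using U that by (rule eventually_nhds_in_open)
  have contM: "isCont (\<lambda>q. M q v) p" if p: "p \<in> U" for p v
  proof -
    obtain C where C: "C > 0" "eventually (\<lambda>q. \<forall>w. norm (M q w) \<le> C * norm w) (nhds p)"
      using bnd[OF p] by blast
    \<comment> \<open>This choice gives \<open>M q v - M p v = M q (h q)\<close>, so the uniform
      bound on \<open>M q\<close> reduces continuity of \<open>M\<close> to that of
      \<open>L\<close>.\<close>
    define h where "h q = L p (M p v) - L q (M p v)" for q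
    have "isCont h p"
      unfolding h_def using contL U p continuous_on_eq_continuous_at by (intro continuous_intros) blast
    then have "(h \<longlongrightarrow> 0) (nhds p)" by (simp add: isCont_def tendsto_nhds_iff h_def)
    then have h0: "((\<lambda>q. C * norm (h q)) \<longlongrightarrow> 0) (nhds p)"
      by (intro tendsto_eq_intros) auto
    have "((\<lambda>q. M q v - M p v) \<longlongrightarrow> 0) (nhds p)"
    proof (rule Lim_null_comparison[OF _ h0])
      show "\<forall>\<^sub>F q in nhds p. norm (M q v - M p v) \<le> C * norm (h q)"
        using C(2) ev[OF p]
      proof eventually_elim
        case (elim q)
        have "M q v - M p v = M q (h q)"
          unfolding h_def using M p elim linM by (simp add: linear_diff)
        then show ?case using elim by simp
      qed
    qed
    then show ?thesis
      by (simp add: isCont_def tendsto_nhds_iff LIM_zero_iff)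
  qed
  show ?thesis
    using L(2)
  proof (induction k arbitrary: v)
    case 0
    show ?case using contM by (simp add: U continuous_on_eq_continuous_at)
  next
    case (Suc k)
    obtain D where D: "\<And>v p. p \<in> U \<Longrightarrow> ((\<lambda>p. L p v) has_derivative D v p) (at p)"
      "\<And>v w. Ck_on k U (\<lambda>p. D v p w)"
    proof (rule that)
      let ?D = "\<lambda>v p. frechet_derivative (\<lambda>p. L p v) (at p)"
      show "((\<lambda>p. L p v) has_derivative ?D v p) (at p)" if "p \<in> U" for v p
        using Suc.prems[of v] that unfolding Ck_on.simps frechet_derivative_works by blast
      show "Ck_on k U (\<lambda>p. ?D v p w)" for v w
        using Suc.prems[of v] unfolding Ck_on.simps by blast
    qed
    have IH: "Ck_on k U (\<lambda>p. M p v)" for v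
      using Suc.IH Suc.prems Ck_on_SucD by blast
    have linD: "linear (D v p)" if "p \<in> U" for p v
      using D(1)[OF that] has_derivative_linear by blast
    \<comment> \<open>Linearity in the parameter \<open>v\<close>, not in the direction
      \<open>w\<close>: it is needed to insert the moving argument \<open>M p v\<close> for
      \<open>v\<close>. It follows from linearity of \<open>L p\<close> and uniqueness of
      derivatives.\<close>
    have linD2: "linear (\<lambda>v. D v p w)" if p: "p \<in> U" for p w
    proof (rule linearI)
      have "((\<lambda>p. L p (x + y)) has_derivative (\<lambda>w. D x p w + D y p w)) (at p)" for x y
        using has_derivative_transform_within_open[OF has_derivative_add[OF D(1)[OF p, of x] D(1)[OF p, of y]] U p]
          L(1) by (simp add: linear_add)
      then show "D (x + y) p w = D x p w + D y p w" for x y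
        using D(1)[OF p] has_derivative_unique by metis
      have "((\<lambda>p. L p (c *\<^sub>R x)) has_derivative (\<lambda>w. c *\<^sub>R D x p w)) (at p)" for x c
        using has_derivative_transform_within_open[OF has_derivative_scaleR_right[OF D(1)[OF p, of x]] U p]
          L(1) by (simp add: linear_cmul)
      then show "D (c *\<^sub>R x) p w = c *\<^sub>R D x p w" for x c
        using D(1)[OF p] has_derivative_unique by metis
    qed
    show ?case
    proof (rule Ck_on_SucI[OF U, where D="\<lambda>p w. - M p (D (M p v) p w)"])
      show "Ck_on k U (\<lambda>p. - M p (D (M p v) p w))" for w
      proof -
        have "Ck_on k U (\<lambda>p. D (M p v) p w)"
          using Ck_on_linear_family_apply[where M="\<lambda>p v. D v p w", OF U linD2 D(2) IH] .
        then have "Ck_on k U (\<lambda>p. M p (D (M p v) p w))"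
          using Ck_on_linear_family_apply[OF U linM IH] by blast
        then show ?thesis
          by (rule Ck_on_bounded_linear[OF bounded_linear_minus[OF bounded_linear_ident] U])
      qed
      show "((\<lambda>p. M p v) has_derivative (\<lambda>w. - M p (D (M p v) p w))) (at p)" if p: "p \<in> U" for p
      proof -
        define u where "u = M p v"
        obtain C where C: "C > 0" "eventually (\<lambda>q. \<forall>w. norm (M q w) \<le> C * norm w) (nhds p)"
          using bnd[OF p] by blast
        have bl: "bounded_linear (\<lambda>w. - M p (D u p w))"
          using linM[OF p] linD[OF p]
          by (auto intro!: bounded_linear_minus bounded_linear_compose[where f="M p"]
              simp: linear_conv_bounded_linear)
        define r where "r q = (1 / norm (q - p)) * norm (L q u - L p u - D u p (q - p))" for q
        have r: "(r \<longlongrightarrow> 0) (at p)"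
          using D(1)[OF p, of u] unfolding has_derivative_iff_norm r_def by simp
        obtain K where K: "K > 0" "\<And>w. norm (D u p w) \<le> K * norm w"
          using linear_bounded_pos[OF linD[OF p]] by metis
        \<comment> \<open>In finite dimension, pointwise convergence of \<open>M q\<close> on the
          basis controls \<open>M q d - M p d\<close> by \<open>norm d * t q\<close>, and
          \<open>K\<close> bounds \<open>norm d\<close> by a multiple of
          \<open>norm (q - p)\<close>.\<close>
        define t where "t q = (\<Sum>b\<in>Basis. norm (M q b - M p b))" for q
        have t: "(t \<longlongrightarrow> 0) (at p)"
          unfolding t_def using contM[OF p] by (intro tendsto_eq_intros) (auto simp: isCont_def)
        have rt: "((\<lambda>q. C * r q + K * t q) \<longlongrightarrow> 0) (at p)"
          using r t by (intro tendsto_eq_intros) auto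
        have est: "norm ((1 / norm (q - p)) * norm (M q v - M p v - - M p (D u p (q - p)))) \<le> C * r q + K * t q"
          if q: "q \<in> U" and Cq: "\<forall>w. norm (M q w) \<le> C * norm w" for q
        proof -
          define d where "d = D u p (q - p)"
          \<comment> \<open>from \<open>M q v - M p v = M q (L p u - L q u)\<close>\<close>
          have "M q v - M p v - - M p d = - M q (L q u - L p u - d) - (M q d - M p d)"
            using M p q linM[OF q] by (simp add: linear_diff u_def)
          then have "norm (M q v - M p v - - M p d) \<le> norm (M q (L q u - L p u - d)) + norm (M q d - M p d)"
            by (metis norm_minus_cancel norm_triangle_ineq4)
          also have "\<dots> \<le> C * norm (L q u - L p u - d) + norm (M q d - M p d)"
            using Cq by simp
          also have "M q d - M p d = (\<Sum>b\<in>Basis. (d \<bullet> b) *\<^sub>R (M q b - M p b))"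
          proof -
            have "linear (\<lambda>d. M q d - M p d)"
              using linM[OF q] linM[OF p] by (rule linear_compose_sub)
            from linear_sum[OF this, of "\<lambda>b. (d \<bullet> b) *\<^sub>R b" Basis] linear_cmul[OF this]
            show ?thesis by (simp add: euclidean_representation)
          qed
          also have "norm \<dots> \<le> (\<Sum>b\<in>Basis. norm d * norm (M q b - M p b))"
            by (intro sum_norm_le) (auto intro!: mult_right_mono Basis_le_norm)
          also have "\<dots> = norm d * t q" by (simp add: t_def sum_distrib_left)
          also have "\<dots> \<le> (K * norm (q - p)) * t q"
            unfolding d_def by (intro mult_right_mono K(2)) (auto simp: t_def intro: sum_nonneg)
          finally have "norm (M q v - M p v - - M p d) \<le> C * norm (L q u - L p u - d) + K * norm (q - p) * t q"
            by simp
          then have "(1 / norm (q - p)) * norm (M q v - M p v - - M p d)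
              \<le> (1 / norm (q - p)) * (C * norm (L q u - L p u - d) + K * norm (q - p) * t q)"
            by (intro mult_left_mono) auto
          \<comment> \<open>For \<open>q = p\<close> the division by zero makes the left side 0, and
            the right side is nonnegative; otherwise \<open>norm (q - p)\<close> cancels.\<close>
          also have "\<dots> \<le> C * r q + K * t q"
            using K(1) by (cases "q = p") (auto simp: r_def d_def field_simps t_def intro!: sum_nonneg mult_nonneg_nonneg)
          finally show ?thesis by (simp add: d_def)
        qed
        have "eventually (\<lambda>q. q \<in> U \<and> (\<forall>w. norm (M q w) \<le> C * norm w)) (at p)"
          using C(2) ev[OF p] by (auto simp: eventually_at_filter elim: eventually_elim2)
        then have "\<forall>\<^sub>F q in at p. norm ((1 / norm (q - p)) * norm (M q v - M p v - - M p (D u p (q - p)))) \<le> C * r q + K * t q"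
          by (rule eventually_mono) (use est in blast)
        from Lim_null_comparison[OF this rt] show ?thesis
          unfolding has_derivative_iff_norm u_def[symmetric] using bl by simp
      qed
    qed
  qed
qed

text \<open>The library's inverse function theorem gives a differentiable \<open>g\<close> with
  derivative \<open>inv (f' (g y))\<close>. This bootstraps: if \<open>g\<close> is of class
  \<open>k\<close>, then so is its derivative, being a smooth inverse family composed with
  \<open>g\<close>, hence \<open>g\<close> is of class \<open>Suc k\<close>.\<close>

theorem smooth_inverse_function:
  fixes f :: "'a::euclidean_space \<Rightarrow> 'a"
  assumes U: "open U" "p \<in> U" and f: "smooth_on U f"
    and D: "(f has_derivative D) (at p)" "\<And>v. D v = 0 \<Longrightarrow> v = 0"
  obtains U' V g where "open U'" "U' \<subseteq> U" "p \<in> U'" "open V" "f p \<in> V" "homeomorphism U' V f g"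
    "smooth_on V g"
proof -
  define f' where "f' x = frechet_derivative f (at x)" for x
  have f': "(f has_derivative f' x) (at x)" if "x \<in> U" for x
    using f that unfolding smooth_on_def f'_def by (metis Ck_on.simps(2) frechet_derivative_works)
  have Ckf': "Ck_on k U (\<lambda>x. f' x v)" for k v
    using f unfolding smooth_on_def f'_def by (metis Ck_on.simps(2))
  have linf': "linear (f' x)" if "x \<in> U" for x
    using f'[OF that] has_derivative_linear by blast
  have A: "blinfun_apply (Blinfun (f' x)) = f' x" if "x \<in> U" for x
    using linf'[OF that] by (simp add: bounded_linear_Blinfun_apply linear_conv_bounded_linear)
  have cont: "continuous_on U (\<lambda>x. Blinfun (f' x))"
    using Ckf'[of 0] by (intro continuous_on_blinfun_componentwise) (simp add: A cong: continuous_on_cong)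
  have Dp: "D = f' p" using D(1) f'[OF U(2)] has_derivative_unique by blast
  \<comment> \<open>In finite dimension an injective linear map has a linear left inverse, which is
    the form of invertibility that \<open>inverse_function_theorem\<close> asks for.\<close>
  have "inj D"
    using D(2) linf'[OF U(2)] linear_injective_0 Dp by blast
  then obtain L where L: "linear L" "L \<circ> D = id"
    using linear_injective_left_inverse linf'[OF U(2)] Dp by blast
  have inv: "Blinfun L o\<^sub>L Blinfun (f' p) = id_blinfun"
    using L A[OF U(2)] Dp
    by (intro blinfun_eqI) (simp add: bounded_linear_Blinfun_apply linear_conv_bounded_linear fun_eq_iff)
  obtain U' V g g' where *: "open U'" "U' \<subseteq> U" "p \<in> U'" "open V" "f p \<in> V" "homeomorphism U' V f g"
    and g: "\<And>y. y \<in> V \<Longrightarrow> (g has_derivative g' y) (at y)"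
      "\<And>y. y \<in> V \<Longrightarrow> g' y = inv (blinfun_apply (Blinfun (f' (g y))))"
      "\<And>y. y \<in> V \<Longrightarrow> bij (blinfun_apply (Blinfun (f' (g y))))"
    using inverse_function_theorem[of U f "\<lambda>x. Blinfun (f' x)" p "Blinfun L"] U f' A cont inv
    by (metis (no_types, lifting))
  have gU: "g y \<in> U'" if "y \<in> V" for y
    using *(6) that by (auto simp: homeomorphism_def)
  have bij: "bij (f' x)" if "x \<in> U'" for x
    using g(3)[of "f x"] that *(2,6) A by (auto simp: homeomorphism_def subset_iff)
  have g'': "g' y = inv (f' (g y))" if "y \<in> V" for y
    using g(2)[OF that] A gU[OF that] *(2) by auto
  have "Ck_on k V g" for k
  proof (induction k)
    case 0
    then show ?case using *(6) by (simp add: homeomorphism_def)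
  next
    case (Suc k)
    show ?case
    proof (rule Ck_on_SucI[OF *(4) g(1)])
      fix v
      have "Ck_on k U' (\<lambda>x. inv (f' x) v)"
      proof (rule Ck_on_linear_family_inverse[OF *(1)])
        show "linear (f' x)" if "x \<in> U'" for x using linf' that *(2) by auto
        show "Ck_on k U' (\<lambda>x. f' x v)" for v using Ck_on_subset[OF Ckf' *(2)] .
        show "inv (f' x) (f' x v) = v" if "x \<in> U'" for x v
          using bij[OF that] by (simp add: bij_is_inj)
        show "f' x (inv (f' x) v) = v" if "x \<in> U'" for x v
          using bij[OF that] by (simp add: bij_is_surj surj_f_inv_f)
      qed
      then have "Ck_on k V (\<lambda>y. inv (f' (g y)) v)"
        using Ck_on_compose[where g="\<lambda>x. inv (f' x) v", OF *(4,1) _ Suc.IH] gU by blast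
      then show "Ck_on k V (\<lambda>y. g' y v)"
        by (rule Ck_on_cong[OF *(4), rotated]) (simp add: g'')
    qed
  qed
  then show ?thesis using that * by (auto simp: smooth_on_def)
qed

subsection \<open>The coordinate change\<close>

text \<open>An implicit function argument: carrying \<open>z\<close> along as a first coordinate
  makes \<open>F\<close> a map between spaces of equal dimension, and its local inverse, restricted
  to the slice \<open>(z, g, c)\<close>, has \<open>\<alpha>\<close> and \<open>\<beta>\<close> as
  its other coordinates. Conjugation makes everything smooth over the reals only.\<close>

lemma solve_coefficients:
  fixes g a b c :: complex
  assumes "g \<noteq> 0"
  obtains W \<alpha> \<beta> where "open W" "0 \<in> W" "smooth_on W \<alpha>" "smooth_on W \<beta>" "\<alpha> 0 = 0"
    "\<And>z. z \<in> W \<Longrightarrow> g * (1 + \<alpha> z) ^ 5 + 5 * cnj g * z ^ 3 * cnj z * (1 + cnj (\<alpha> z)) * cnj (\<beta> z) ^ 4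
       + cnj g * z ^ 5 * cnj (\<beta> z) ^ 5 = g + a * z + b * cnj z"
    "\<And>z. z \<in> W \<Longrightarrow> 5 * g * (1 + \<alpha> z) ^ 4 * \<beta> z + 10 * cnj g * cnj z * (1 + cnj (\<alpha> z)) ^ 3 * cnj (\<beta> z) ^ 2
       + 10 * cnj g * z ^ 2 * (1 + cnj (\<alpha> z)) ^ 2 * cnj (\<beta> z) ^ 3 = c"
proof -
  define E1 where "E1 w = g * (1 + fst (snd w)) ^ 5
    + 5 * cnj g * fst w ^ 3 * cnj (fst w) * (1 + cnj (fst (snd w))) * cnj (snd (snd w)) ^ 4
    + cnj g * fst w ^ 5 * cnj (snd (snd w)) ^ 5 - a * fst w - b * cnj (fst w)" for w
  define E2 where "E2 w = 5 * g * (1 + fst (snd w)) ^ 4 * snd (snd w)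
    + 10 * cnj g * cnj (fst w) * (1 + cnj (fst (snd w))) ^ 3 * cnj (snd (snd w)) ^ 2
    + 10 * cnj g * fst w ^ 2 * (1 + cnj (fst (snd w))) ^ 2 * cnj (snd (snd w)) ^ 3" for w
  define F :: "complex \<times> complex \<times> complex \<Rightarrow> complex \<times> complex \<times> complex"
    where "F w = (fst w, E1 w, E2 w)" for w
  define b0 where "b0 = c / (5 * g)"
  define w0 :: "complex \<times> complex \<times> complex" where "w0 = (0, 0, b0)"
  \<comment> \<open>The derivative of \<open>F\<close> at \<open>w0\<close> is block triangular with
    diagonal 1, \<open>5 * g\<close>, \<open>5 * g\<close>, so injectivity follows coordinate by
    coordinate from \<open>g \<noteq> 0\<close>.\<close>
  define D :: "complex \<times> complex \<times> complex \<Rightarrow> complex \<times> complex \<times> complex"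
    where "D w = (fst w, 5 * g * fst (snd w) - a * fst w - b * cnj (fst w),
      5 * g * snd (snd w) + 20 * g * b0 * fst (snd w) + 10 * cnj g * cnj (fst w) * cnj b0 ^ 2)" for w
  have smF: "smooth_on UNIV F"
    unfolding F_def E1_def E2_def by (intro smooth_on_intros open_UNIV)
  have derF: "(F has_derivative D) (at w0)"
    unfolding F_def E1_def E2_def D_def
    by (rule derivative_eq_intros bounded_linear.has_derivative[OF bounded_linear_cnj] refl
        | simp add: w0_def fun_eq_iff algebra_simps)+
  have injD: "w = 0" if "D w = 0" for w
  proof -
    have "fst w = 0" using that by (simp add: D_def zero_prod_def)
    moreover from this have "fst (snd w) = 0" using that assms by (simp add: D_def zero_prod_def)
    ultimately show ?thesis using that assms by (auto simp: D_def zero_prod_def prod_eq_iff)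
  qed
  have F0: "F w0 = (0, g, c)"
    using assms by (simp add: F_def E1_def E2_def w0_def b0_def)
  obtain U V G where G: "open U" "w0 \<in> U" "open V" "F w0 \<in> V" "homeomorphism U V F G" "smooth_on V G"
    using smooth_inverse_function[OF open_UNIV _ smF derF injD] by (metis UNIV_I)
  define j where "j z = (z, g, c)" for z :: complex
  define W where "W = j -` V"
  have smj: "smooth_on S j" if "open S" for S
    unfolding j_def by (intro smooth_on_intros that)
  have "continuous_on UNIV j" unfolding j_def by (intro continuous_intros)
  then have W: "open W" unfolding W_def using G(3) by (metis open_vimage)
  have W0: "0 \<in> W" using G(4) by (simp add: W_def j_def F0)
  have smG: "smooth_on W (\<lambda>z. G (j z))"
    by (rule smooth_on_compose[OF W G(3) _ smj[OF W] G(6)]) (auto simp: W_def)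
  have FG: "F (G (j z)) = (z, g, c)" if "z \<in> W" for z
    using that G(5) by (auto simp: W_def homeomorphism_def j_def)
  have GF: "G (F w0) = w0"
    using G(2,5) by (auto simp: homeomorphism_def)
  define \<alpha> where "\<alpha> z = fst (snd (G (j z)))" for z
  define \<beta> where "\<beta> z = snd (snd (G (j z)))" for z
  have fstG: "fst (G (j z)) = z" if "z \<in> W" for z
    using FG[OF that] by (simp add: F_def)
  show ?thesis
  proof (rule that[of W \<alpha> \<beta>])
    show "smooth_on W \<alpha>" "smooth_on W \<beta>"
      unfolding \<alpha>_def \<beta>_def by (intro smooth_on_intros W smG)+
    show "\<alpha> 0 = 0"
      using GF[unfolded F0] by (simp add: \<alpha>_def j_def w0_def)
    fix z assume z: "z \<in> W"
    have "E1 (G (j z)) = g" "E2 (G (j z)) = c" using FG[OF z] by (simp_all add: F_def)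
    then show "g * (1 + \<alpha> z) ^ 5 + 5 * cnj g * z ^ 3 * cnj z * (1 + cnj (\<alpha> z)) * cnj (\<beta> z) ^ 4
       + cnj g * z ^ 5 * cnj (\<beta> z) ^ 5 = g + a * z + b * cnj z"
     "5 * g * (1 + \<alpha> z) ^ 4 * \<beta> z + 10 * cnj g * cnj z * (1 + cnj (\<alpha> z)) ^ 3 * cnj (\<beta> z) ^ 2
       + 10 * cnj g * z ^ 2 * (1 + cnj (\<alpha> z)) ^ 2 * cnj (\<beta> z) ^ 3 = c"
      by (simp_all add: E1_def E2_def \<alpha>_def \<beta>_def fstG[OF z] algebra_simps)
  qed (fact W W0)+
qed

text \<open>In the binomial expansion, the terms of degree 2 and 3 in \<beta> become multiples of
  \<open>z ^ 4 * cnj z ^ 2\<close> after conjugation and complete the second equation; those of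
  degree 4 and 5 become multiples of \<open>z ^ 5\<close> and complete the first.\<close>

lemma Re_fifth_power_substitution:
  fixes g a b c z \<alpha> \<beta> :: complex
  assumes "g * (1 + \<alpha>) ^ 5 + 5 * cnj g * z ^ 3 * cnj z * (1 + cnj \<alpha>) * cnj \<beta> ^ 4
       + cnj g * z ^ 5 * cnj \<beta> ^ 5 = g + a * z + b * cnj z"
    and "5 * g * (1 + \<alpha>) ^ 4 * \<beta> + 10 * cnj g * cnj z * (1 + cnj \<alpha>) ^ 3 * cnj \<beta> ^ 2
       + 10 * cnj g * z ^ 2 * (1 + cnj \<alpha>) ^ 2 * cnj \<beta> ^ 3 = c"
  shows "Re (g * (z * (1 + \<alpha>) + cnj z ^ 2 * \<beta>) ^ 5)
    = Re (g * z ^ 5 + a * z ^ 6 + b * z ^ 5 * cnj z + c * z ^ 4 * cnj z ^ 2)"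
proof -
  define e where "e = 1 + \<alpha>"
  have cnj_e: "1 + cnj \<alpha> = cnj e" by (simp add: e_def)
  note coeff_eqs = assms[unfolded cnj_e e_def[symmetric]]
  define P where "P = g * z ^ 5 * e ^ 5 + 5 * g * z ^ 4 * e ^ 4 * cnj z ^ 2 * \<beta>"
  \<comment> \<open>the part that is divisible by \<open>z\<^sup>4\<close> only after conjugation\<close>
  define Q where "Q = 10 * g * z ^ 3 * e ^ 3 * cnj z ^ 4 * \<beta> ^ 2
    + 10 * g * z ^ 2 * e ^ 2 * cnj z ^ 6 * \<beta> ^ 3 + 5 * g * z * e * cnj z ^ 8 * \<beta> ^ 4
    + g * cnj z ^ 10 * \<beta> ^ 5"
  have binom: "(u + v) ^ 5 = u^5 + 5 * u^4 * v + 10 * u^3 * v^2 + 10 * u^2 * v^3 + 5 * u * v^4 + v^5"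
    for u v :: complex by algebra
  have "g * (z * e + cnj z ^ 2 * \<beta>) ^ 5 = P + Q"
    unfolding binom P_def Q_def by (simp add: power_mult_distrib algebra_simps flip: power_mult)
  then have "Re (g * (z * e + cnj z ^ 2 * \<beta>) ^ 5) = Re (P + cnj Q)"
    by simp
  also have "P + cnj Q = z ^ 4 * (z * (g + a * z + b * cnj z) + cnj z ^ 2 * c)"
    unfolding coeff_eqs[symmetric] P_def Q_def by (simp add: eval_nat_numeral algebra_simps)
  also have "\<dots> = g * z ^ 5 + a * z ^ 6 + b * z ^ 5 * cnj z + c * z ^ 4 * cnj z ^ 2"
    by (simp add: eval_nat_numeral algebra_simps)
  finally show ?thesis by (simp add: e_def)
qed

subsection \<open>Normal forms of the two polynomials\<close>

lemma smooth_on_homogeneous_poly: "homogeneous_poly d f \<Longrightarrow> smooth_on UNIV f"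
  unfolding homogeneous_poly_def case_prod_beta
  by (auto intro!: smooth_on_intros open_UNIV)

lemma harmonic_quintic:
  assumes "homogeneous_poly 5 h" "harmonic h"
  obtains g where "\<And>x y. h (x, y) = Re (g * Complex x y ^ 5)"
proof -
  obtain c where h: "h = (\<lambda>(x, y). \<Sum>i\<le>5. c i * x ^ i * y ^ (5 - i))"
    using assms(1) by (auto simp: homogeneous_poly_def)
  have h': "h = (\<lambda>(x, y). c 0 * y^5 + c 1 * x * y^4 + c 2 * x^2 * y^3 + c 3 * x^3 * y^2 + c 4 * x^4 * y + c 5 * x^5)"
    unfolding h by (simp add: eval_nat_numeral)
  have px: "partial_x h = (\<lambda>(x, y). c 1 * y^4 + 2 * c 2 * x * y^3 + 3 * c 3 * x^2 * y^2 + 4 * c 4 * x^3 * y + 5 * c 5 * x^4)"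
    unfolding h' partial_x_def
    by (auto simp: fun_eq_iff algebra_simps intro!: DERIV_imp_deriv derivative_eq_intros)
  have pxx: "partial_x (partial_x h) = (\<lambda>(x, y). 2 * c 2 * y^3 + 6 * c 3 * x * y^2 + 12 * c 4 * x^2 * y + 20 * c 5 * x^3)"
    unfolding px unfolding partial_x_def
    by (auto simp: fun_eq_iff algebra_simps intro!: DERIV_imp_deriv derivative_eq_intros)
  have py: "partial_y h = (\<lambda>(x, y). 5 * c 0 * y^4 + 4 * c 1 * x * y^3 + 3 * c 2 * x^2 * y^2 + 2 * c 3 * x^3 * y + c 4 * x^4)"
    unfolding h' partial_y_def
    by (auto simp: fun_eq_iff algebra_simps intro!: DERIV_imp_deriv derivative_eq_intros)
  have pyy: "partial_y (partial_y h) = (\<lambda>(x, y). 20 * c 0 * y^3 + 12 * c 1 * x * y^2 + 6 * c 2 * x^2 * y + 2 * c 3 * x^3)"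
    unfolding py unfolding partial_y_def
    by (auto simp: fun_eq_iff algebra_simps intro!: DERIV_imp_deriv derivative_eq_intros)
  have lap: "laplacian h (x, y) = 0" for x y
    using assms(2) by (simp add: harmonic_def)
  have lap': "(2 * c 2 + 20 * c 0) * y^3 + (6 * c 3 + 12 * c 1) * x * y^2 + (12 * c 4 + 6 * c 2) * x^2 * y
      + (20 * c 5 + 2 * c 3) * x^3 = 0" for x y
    using lap[of x y] unfolding laplacian_def pxx pyy by (simp add: algebra_simps)
  \<comment> \<open>The Laplacian is a cubic form; its values at these four points force its four
    coefficients to vanish, leaving \<open>c 0\<close> and \<open>c 5\<close> free.\<close>
  have "c 2 = - 10 * c 0" "c 3 = - 10 * c 5" "c 1 = 5 * c 5" "c 4 = 5 * c 0"
    using lap'[of 0 1] lap'[of 1 0] lap'[of 1 1] lap'[of 1 "-1"] by simp_all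
  \<comment> \<open>In \<open>Re (g * Complex x y ^ 5)\<close> the coefficient of
    \<open>x ^ 5\<close> is \<open>Re g\<close> and that of \<open>y ^ 5\<close> is
    \<open>- Im g\<close>, which dictates \<open>g\<close>.\<close>
  then have "h (x, y) = Re (Complex (c 5) (- c 0) * Complex x y ^ 5)" for x y
    by (simp add: h' eval_nat_numeral algebra_simps)
  then show ?thesis using that by blast
qed

text \<open>With explicit coefficients, this formula and those for degrees 2 and 6 chain as rewrite
  rules and reduce the threefold Laplacian of a sextic to a constant.\<close>

lemma laplacian_quartic:
  "laplacian (\<lambda>(x, y). c0 * y^4 + c1 * x * y^3 + c2 * x^2 * y^2 + c3 * x^3 * y + c4 * x^4)
    = (\<lambda>(x, y). (2 * c2 + 12 * c0) * y^2 + (6 * c3 + 6 * c1) * x * y + (12 * c4 + 2 * c2) * x^2)"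
  (is "laplacian ?f = _")
proof -
  have px: "partial_x ?f = (\<lambda>(x, y). c1 * y^3 + 2 * c2 * x * y^2 + 3 * c3 * x^2 * y + 4 * c4 * x^3)"
    unfolding partial_x_def
    by (auto simp: fun_eq_iff algebra_simps intro!: DERIV_imp_deriv derivative_eq_intros)
  have pxx: "partial_x (partial_x ?f) = (\<lambda>(x, y). 2 * c2 * y^2 + 6 * c3 * x * y + 12 * c4 * x^2)"
    unfolding px unfolding partial_x_def
    by (auto simp: fun_eq_iff algebra_simps intro!: DERIV_imp_deriv derivative_eq_intros)
  have py: "partial_y ?f = (\<lambda>(x, y). 4 * c0 * y^3 + 3 * c1 * x * y^2 + 2 * c2 * x^2 * y + c3 * x^3)"
    unfolding partial_y_def
    by (auto simp: fun_eq_iff algebra_simps intro!: DERIV_imp_deriv derivative_eq_intros)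
  have pyy: "partial_y (partial_y ?f) = (\<lambda>(x, y). 12 * c0 * y^2 + 6 * c1 * x * y + 2 * c2 * x^2)"
    unfolding py unfolding partial_y_def
    by (auto simp: fun_eq_iff algebra_simps intro!: DERIV_imp_deriv derivative_eq_intros)
  show ?thesis unfolding laplacian_def pxx pyy by (auto simp: algebra_simps)
qed

lemma laplacian_quadratic:
  "laplacian (\<lambda>(x, y). c0 * y^2 + c1 * x * y + c2 * x^2) = (\<lambda>_. 2 * c0 + 2 * c2)"
  (is "laplacian ?f = _")
proof -
  have px: "partial_x ?f = (\<lambda>(x, y). c1 * y + 2 * c2 * x)"
    unfolding partial_x_def
    by (auto simp: fun_eq_iff algebra_simps intro!: DERIV_imp_deriv derivative_eq_intros)
  have pxx: "partial_x (partial_x ?f) = (\<lambda>_. 2 * c2)"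
    unfolding px unfolding partial_x_def
    by (auto simp: fun_eq_iff algebra_simps intro!: DERIV_imp_deriv derivative_eq_intros)
  have py: "partial_y ?f = (\<lambda>(x, y). 2 * c0 * y + c1 * x)"
    unfolding partial_y_def
    by (auto simp: fun_eq_iff algebra_simps intro!: DERIV_imp_deriv derivative_eq_intros)
  have pyy: "partial_y (partial_y ?f) = (\<lambda>_. 2 * c0)"
    unfolding py unfolding partial_y_def
    by (auto simp: fun_eq_iff algebra_simps intro!: DERIV_imp_deriv derivative_eq_intros)
  show ?thesis unfolding laplacian_def pxx pyy by auto
qed

lemma laplacian_sextic:
  "laplacian (\<lambda>(x, y). c0 * y^6 + c1 * x * y^5 + c2 * x^2 * y^4 + c3 * x^3 * y^3 + c4 * x^4 * y^2
      + c5 * x^5 * y + c6 * x^6)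
    = (\<lambda>(x, y). (2 * c2 + 30 * c0) * y^4 + (6 * c3 + 20 * c1) * x * y^3 + (12 * c4 + 12 * c2) * x^2 * y^2
      + (20 * c5 + 6 * c3) * x^3 * y + (30 * c6 + 2 * c4) * x^4)"
  (is "laplacian ?f = _")
proof -
  have px: "partial_x ?f = (\<lambda>(x, y). c1 * y^5 + 2 * c2 * x * y^4 + 3 * c3 * x^2 * y^3 + 4 * c4 * x^3 * y^2
      + 5 * c5 * x^4 * y + 6 * c6 * x^5)"
    unfolding partial_x_def
    by (auto simp: fun_eq_iff algebra_simps intro!: DERIV_imp_deriv derivative_eq_intros)
  have pxx: "partial_x (partial_x ?f) = (\<lambda>(x, y). 2 * c2 * y^4 + 6 * c3 * x * y^3 + 12 * c4 * x^2 * y^2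
      + 20 * c5 * x^3 * y + 30 * c6 * x^4)"
    unfolding px unfolding partial_x_def
    by (auto simp: fun_eq_iff algebra_simps intro!: DERIV_imp_deriv derivative_eq_intros)
  have py: "partial_y ?f = (\<lambda>(x, y). 6 * c0 * y^5 + 5 * c1 * x * y^4 + 4 * c2 * x^2 * y^3 + 3 * c3 * x^3 * y^2
      + 2 * c4 * x^4 * y + c5 * x^5)"
    unfolding partial_y_def
    by (auto simp: fun_eq_iff algebra_simps intro!: DERIV_imp_deriv derivative_eq_intros)
  have pyy: "partial_y (partial_y ?f) = (\<lambda>(x, y). 30 * c0 * y^4 + 20 * c1 * x * y^3 + 12 * c2 * x^2 * y^2
      + 6 * c3 * x^3 * y + 2 * c4 * x^4)"
    unfolding py unfolding partial_y_def
    by (auto simp: fun_eq_iff algebra_simps intro!: DERIV_imp_deriv derivative_eq_intros)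
  show ?thesis unfolding laplacian_def pxx pyy by (auto simp: algebra_simps)
qed

text \<open>The third Laplacian of a sextic form is constant, so its vanishing is a single linear
  relation among seven real coefficients. The remaining six dimensions match the real and imaginary
  parts of \<open>a\<close>, \<open>b\<close> and \<open>c\<close>.\<close>

lemma three_harmonic_sextic:
  assumes "homogeneous_poly 6 r" "l_harmonic 3 r"
  obtains a b c where "\<And>x y. r (x, y) = Re (a * Complex x y ^ 6 + b * Complex x y ^ 5 * cnj (Complex x y)
    + c * Complex x y ^ 4 * cnj (Complex x y) ^ 2)"
proof -
  obtain d where r: "r = (\<lambda>(x, y). \<Sum>i\<le>6. d i * x ^ i * y ^ (6 - i))"
    using assms(1) by (auto simp: homogeneous_poly_def)
  have r': "r = (\<lambda>(x, y). d 0 * y^6 + d 1 * x * y^5 + d 2 * x^2 * y^4 + d 3 * x^3 * y^3 + d 4 * x^4 * y^2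
      + d 5 * x^5 * y + d 6 * x^6)"
    unfolding r by (simp add: eval_nat_numeral)
  have "laplacian (laplacian (laplacian r)) 0 = 0"
    using assms(2) by (simp add: l_harmonic_def eval_nat_numeral)
  then have lap: "5 * d 6 + d 4 + d 2 + 5 * d 0 = 0"
    unfolding r' laplacian_sextic laplacian_quartic laplacian_quadratic by simp
  \<comment> \<open>These values solve the linear system \<open>d\<close> below. The coefficients of
    even index involve only the real parts and are consistent because of \<open>lap\<close>; those
    of odd index involve only the imaginary parts.\<close>
  define a1 b1 c1 where "a1 = (d 6 - d 0 - d 4 + d 2) / 32" and "b1 = (d 6 + d 0) / 2"
    and "c1 = (d 6 - d 0) / 2 - a1"
  define a2 b2 c2 where "a2 = - (d 5 + d 1 - d 3) / 32" and "b2 = - (d 5 - d 1) / 8"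
    and "c2 = 5 * a2 - d 3 / 4"
  have d: "d 6 = a1 + b1 + c1" "d 4 = - 15 * a1 - 5 * b1 + c1" "d 2 = 15 * a1 - 5 * b1 - c1"
    "d 0 = - a1 + b1 - c1" "d 5 = - 6 * a2 - 4 * b2 - 2 * c2" "d 3 = 20 * a2 - 4 * c2"
    "d 1 = - 6 * a2 + 4 * b2 - 2 * c2"
    using lap by (simp_all add: a1_def b1_def c1_def a2_def b2_def c2_def field_simps)
  have "r (x, y) = Re (Complex a1 a2 * Complex x y ^ 6 + Complex b1 b2 * Complex x y ^ 5 * cnj (Complex x y)
    + Complex c1 c2 * Complex x y ^ 4 * cnj (Complex x y) ^ 2)" for x y
    unfolding r' d by (simp add: eval_nat_numeral algebra_simps)
  then show ?thesis using that by blast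
qed

subsection \<open>Right equivalence\<close>

theorem corollary1:
  fixes h5 \<rho>6 :: "real \<times> real \<Rightarrow> real"
  assumes "homogeneous_poly 5 h5" and "h5 \<noteq> (\<lambda>_. 0)" and "harmonic h5"
    and "homogeneous_poly 6 \<rho>6" and "l_harmonic 3 \<rho>6"
  shows "right_equivalent (\<lambda>p. h5 p + \<rho>6 p) h5"
proof -
  define Z :: "real \<times> real \<Rightarrow> complex" where "Z p = Complex (fst p) (snd p)" for p
  define R :: "complex \<Rightarrow> real \<times> real" where "R z = (Re z, Im z)" for z
  have ZR [simp]: "Z (R z) = z" and RZ [simp]: "R (Z p) = p" for z p by (simp_all add: Z_def R_def)
  obtain g where g: "\<And>p. h5 p = Re (g * Z p ^ 5)"
    using harmonic_quintic[OF assms(1,3)] unfolding Z_def by (metis prod.collapse)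
  \<comment> \<open>Here \<open>h5\<close> being non-zero enters; it makes the coefficient equations
    solvable.\<close>
  have "g \<noteq> 0" using assms(2) g by auto
  obtain a b c where r: "\<And>p. \<rho>6 p = Re (a * Z p ^ 6 + b * Z p ^ 5 * cnj (Z p) + c * Z p ^ 4 * cnj (Z p) ^ 2)"
    using three_harmonic_sextic[OF assms(4,5)] unfolding Z_def by (metis prod.collapse)
  obtain W \<alpha> \<beta> where W: "open W" "0 \<in> W" and sm: "smooth_on W \<alpha>" "smooth_on W \<beta>" and \<alpha>0: "\<alpha> 0 = 0"
    and eqs: "\<And>z. z \<in> W \<Longrightarrow> g * (1 + \<alpha> z) ^ 5 + 5 * cnj g * z ^ 3 * cnj z * (1 + cnj (\<alpha> z)) * cnj (\<beta> z) ^ 4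
       + cnj g * z ^ 5 * cnj (\<beta> z) ^ 5 = g + a * z + b * cnj z"
    "\<And>z. z \<in> W \<Longrightarrow> 5 * g * (1 + \<alpha> z) ^ 4 * \<beta> z + 10 * cnj g * cnj z * (1 + cnj (\<alpha> z)) ^ 3 * cnj (\<beta> z) ^ 2
       + 10 * cnj g * z ^ 2 * (1 + cnj (\<alpha> z)) ^ 2 * cnj (\<beta> z) ^ 3 = c"
    using solve_coefficients[OF \<open>g \<noteq> 0\<close>, of a b c] by blast
  define s where "s z = z * (1 + \<alpha> z) + cnj z ^ 2 * \<beta> z" for z
  define S where "S = (\<lambda>p. R (s (Z p)))"
  define N where "N = Z -` W"
  have blZ: "bounded_linear Z"
    unfolding Z_def by (rule bounded_linear_intro[of _ 1])
      (auto simp: complex_eq_iff norm_prod_def cmod_def)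
  have blR: "bounded_linear R"
    unfolding R_def by (intro bounded_linear_Pair bounded_linear_Re bounded_linear_Im)
  have Z0 [simp]: "Z 0 = 0" by (simp add: Z_def complex_eq_iff)
  have R0 [simp]: "R 0 = 0" by (simp add: R_def zero_prod_def)
  have N: "open N" "0 \<in> N"
    unfolding N_def using W linear_continuous_on[OF blZ, of UNIV] by (auto intro!: open_vimage)
  have smZ: "smooth_on N Z"
    using smooth_on_bounded_linear[OF blZ N(1) smooth_on_ident[OF N(1)]] .
  have "smooth_on W s"
    unfolding s_def by (intro smooth_on_intros W sm)
  then have smS: "smooth_on N S"
    unfolding S_def
    by (intro smooth_on_bounded_linear[OF blR N(1)] smooth_on_compose[OF N(1) W(1) _ smZ]) (auto simp: N_def)
  have "\<exists>A. (f has_derivative A) (at z)" if "smooth_on W f" "z \<in> W" for f :: "complex \<Rightarrow> complex" and z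
    using that unfolding smooth_on_def by (metis Ck_on.simps(2) differentiable_def)
  then obtain A B where AB: "(\<alpha> has_derivative A) (at 0)" "(\<beta> has_derivative B) (at 0)"
    using sm W(2) by metis
  \<comment> \<open>Both \<open>z * \<alpha> z\<close> and \<open>cnj z ^ 2 * \<beta> z\<close>
    vanish to second order at 0, the former because \<open>\<alpha> 0 = 0\<close>.\<close>
  have "(s has_derivative (\<lambda>v. v)) (at 0)"
    unfolding s_def
    by (rule derivative_eq_intros bounded_linear.has_derivative[OF bounded_linear_cnj] AB refl
        | simp add: \<alpha>0)+
  then have "(s has_derivative (\<lambda>v. v)) (at (Z 0))" by simp
  from bounded_linear.has_derivative[OF blR
      has_derivative_compose[OF bounded_linear_imp_has_derivative[OF blZ] this]]
  have derS: "(S has_derivative (\<lambda>v. v)) (at 0)"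
    by (simp add: S_def)
  obtain U V \<tau> where UV: "open U" "U \<subseteq> N" "0 \<in> U" "open V" "S 0 \<in> V" "homeomorphism U V S \<tau>"
    and sm\<tau>: "smooth_on V \<tau>"
    using smooth_inverse_function[OF N smS derS] by blast
  have S0: "S 0 = 0" by (simp add: S_def s_def)
  have eq: "h5 p + \<rho>6 p = h5 (S p)" if "p \<in> U" for p
  proof -
    have "Z p \<in> W" using that UV(2) by (auto simp: N_def)
    from Re_fifth_power_substitution[OF eqs[OF this]]
    show ?thesis unfolding g r S_def s_def by simp
  qed
  \<comment> \<open>The substitution \<open>S\<close> carries \<open>h5\<close> to the sum, whereas
    \<open>right_equivalent\<close> composes the sum with the diffeomorphism; so the witness is the
    inverse of \<open>S\<close>, with \<open>U\<close> and \<open>V\<close> exchanged.\<close>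
  have "diffeomorphism_germ \<tau>"
    unfolding diffeomorphism_germ_def
  proof (intro conjI exI)
    show "\<tau> 0 = 0" using UV(3,6) S0 by (metis homeomorphism_apply1)
    show "0 \<in> V" using UV(5) S0 by simp
    show "homeomorphism V U \<tau> S" using UV(6) by (rule homeomorphism_symD)
    show "smooth_on U S" using smS UV(2) by (rule smooth_on_subset)
  qed (fact UV sm\<tau>)+
  moreover have "eventually (\<lambda>p. ((\<lambda>p. h5 p + \<rho>6 p) \<circ> \<tau>) p = h5 p) (nhds 0)"
  proof (rule eventually_mono[OF eventually_nhds_in_open[OF UV(4,5)[unfolded S0]]])
    fix q assume "q \<in> V"
    then show "((\<lambda>p. h5 p + \<rho>6 p) \<circ> \<tau>) q = h5 q"
      using eq[of "\<tau> q"] UV(6) by (auto simp: homeomorphism_def)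
  qed
  moreover have "smooth_on UNIV h5" "smooth_on UNIV \<rho>6"
    using assms(1,4) smooth_on_homogeneous_poly by blast+
  moreover from this have "smooth_on UNIV (\<lambda>p. h5 p + \<rho>6 p)"
    by (rule smooth_on_add[OF open_UNIV])
  moreover have "h5 0 = 0" "\<rho>6 0 = 0" by (simp_all add: g r)
  ultimately show ?thesis
    unfolding right_equivalent_def smooth_function_germ_def by (auto intro!: exI[of _ UNIV])
qed

end
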